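(* Let $\alpha>0$. In the coordinates $\tilde{\boldsymbol x}(k)$, $\tilde{\boldsymbol y}(k)$, both DIGing and AugDGM can be represented as the interconnection of (a) the average state subsystem $\tilde x_1(k+1)=\tilde x_1(k)-\alpha\tilde y_1(k)$, driven by the component $\tilde y_1$ (the average gradient) of the state of (b), and (b) the gradient tracking subsystem, which is the feedback loop of a linear time-invariant system with state $(\tilde{\boldsymbol x}_{2:N},\tilde{\boldsymbol y})$, input $\tilde{\boldsymbol u}$, output $\tilde{\boldsymbol v}$ and diagonal transfer matrix $G(z)$ with the nonlinearity $\tilde{\boldsymbol u}(k)=\tilde\varDelta_{\boldsymbol f}(\tilde{\boldsymbol v}(k))$. Furthermore, $G(z)=C(zI-A)^{-1}B$ is given as follows. (1) For DIGing (with $(A,B,C)=(A^{DG},B^{DG},C^{DG})$), $G^{DG}(z)=\mathrm{diag}\{g_1^{DG}(z),\dots,g_N^{DG}(z)\}\otimes I_d$, where $$g_1^{DG}(z)=-\frac{\alpha}{z-1},\qquad g_i^{DG}(z)=-\frac{\alpha(z-1)}{(z-\lambda_i)^2},\quad i=2,\dots,N.$$ (2) For AugDGM (with $(A,B,C)=(A^{AD},B^{AD},C^{AD})$), $G^{AD}(z)=\mathrm{diag}\{g_1^{AD}(z),\dots,g_N^{AD}(z)\}\otimes I_d$, where $$g_1^{AD}(z)=-\frac{\alpha}{z-1},\qquad g_i^{AD}(z)=-\frac{\alpha(z-1)\lambda_i^2}{(z-\lambda_i)^2},\quad i=2,\dots,N.$$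
   Context: Let $N\ge2$, $d\ge1$, and let $f_1,\dots,f_N:\mathbb R^d\to\mathbb R$ be differentiable, $\mu$-strongly convex and $L$-smooth ($0<\mu\le L$); $\boldsymbol x=(x_1,\dots,x_N)\in\mathbb R^{Nd}$, $\boldsymbol f(\boldsymbol x)=\sum_i f_i(x_i)$, $\nabla\boldsymbol f(\boldsymbol x)=(\nabla f_1(x_1),\dots,\nabla f_N(x_N))$. The weight matrix $W\in\mathbb R^{N\times N}$ of the connected communication graph satisfies $W=W^T$, $W\mathbf 1=\mathbf 1$, $\rho(W-\mathbf 1\mathbf 1^T/N)<1$; write $W=U\varLambda U^T$ with $U=[\frac1{\sqrt N}\mathbf 1,U_2,\dots,U_N]$ orthogonal, $\varLambda=\mathrm{diag}\{1,\lambda_2,\dots,\lambda_N\}$, $1>\lambda_2\ge\dots\ge\lambda_N>-1$, $\varLambda_{2:N}=\mathrm{diag}\{\lambda_2,\dots,\lambda_N\}$. DIGing: $\boldsymbol x(k+1)=(W\otimes I_d)\boldsymbol x(k)-\alpha\boldsymbol y(k)$, $\boldsymbol y(k+1)=(W\otimes I_d)\boldsymbol y(k)+\nabla\boldsymbol f(\boldsymbol x(k+1))-\nabla\boldsymbol f(\boldsymbol x(k))$. AugDGM: $\boldsymbol x(k+1)=(W\otimes I_d)(\boldsymbol x(k)-\alpha\boldsymbol y(k))$, $\boldsymbol y(k+1)=(W\otimes I_d)(\boldsymbol y(k)+\nabla\boldsymbol f(\boldsymbol x(k+1))-\nabla\boldsymbol f(\boldsymbol x(k)))$. Transformed variables: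 $\tilde{\boldsymbol x}(k)=(U^T\otimes I_d)\boldsymbol x(k)$, $\tilde{\boldsymbol y}(k)=(U^T\otimes I_d)\boldsymbol y(k)$, with blocks $\tilde x_i,\tilde y_i\in\mathbb R^d$ and $\tilde{\boldsymbol x}_{2:N}=(\tilde x_2,\dots,\tilde x_N)$. $\nabla\boldsymbol f(\tilde{\boldsymbol x})$ denotes the gradient of $\boldsymbol f$ with respect to $\tilde{\boldsymbol x}$, i.e. $\nabla\boldsymbol f(\tilde{\boldsymbol x})=(U^T\otimes I_d)\nabla\boldsymbol f(\boldsymbol x)$ with $\boldsymbol x=(U\otimes I_d)\tilde{\boldsymbol x}$. Put $\tilde{\boldsymbol u}(k)=\nabla\boldsymbol f(\tilde{\boldsymbol x}(k+1))-\nabla\boldsymbol f(\tilde{\boldsymbol x}(k))$ and $\tilde{\boldsymbol v}(k)=\tilde{\boldsymbol x}(k+1)-\tilde{\boldsymbol x}(k)$; $\tilde\varDelta_{\boldsymbol f}$ denotes the nonlinear operator taking $\tilde{\boldsymbol v}(k)$ to $\tilde{\boldsymbol u}(k)$. State-space matrices of the gradient tracking subsystem (state $(\tilde{\boldsymbol x}_{2:N},\tilde{\boldsymbol y})$, next state $=A\cdot$state$+B\tilde{\boldsymbol u}(k)$, $\tilde{\boldsymbol v}(k)=C\cdot$state): $$A^{DG}=\begin{bmatrix}\varLambda_{2:N}&[\,0_{(N-1)\times1}\ \ -\alpha I_{N-1}\,]\\ 0_{N\times(N-1)}&\varLambda\end{bmatrix}\otimes I_d,\quad B^{DG}=\begin{bmatrix}0_{(N-1)\times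 N}\\ I_N\end{bmatrix}\otimes I_d,\quad C^{DG}=\left[\begin{matrix}0_{1\times(N-1)}\\ \varLambda_{2:N}-I_{N-1}\end{matrix}\ \middle|\ -\alpha I_N\right]\otimes I_d,$$ $$A^{AD}=\begin{bmatrix}\varLambda_{2:N}&[\,0_{(N-1)\times1}\ \ -\alpha\varLambda_{2:N}\,]\\ 0_{N\times(N-1)}&\varLambda\end{bmatrix}\otimes I_d,\quad B^{AD}=\begin{bmatrix}0_{(N-1)\times N}\\ \varLambda\end{bmatrix}\otimes I_d,\quad C^{AD}=\left[\begin{matrix}0_{1\times(N-1)}\\ \varLambda_{2:N}-I_{N-1}\end{matrix}\ \middle|\ -\alpha\varLambda\right]\otimes I_d.$$ *)

theory Defs
  imports "HOL-Analysis.Analysis"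
begin

text \<open>
  The index set \<open>{1,\<dots>,N}\<close> with \<open>N \<ge> 2\<close> is the type \<open>1 + 'm\<close>, the disjoint sum of the one-element
  type \<open>1\<close> and a nonempty finite linearly ordered type \<open>'m\<close> with \<open>N - 1\<close> elements: \<open>Inl 1\<close> is the
  index 1 and \<open>Inr i\<close> ranges over \<open>2,\<dots>,N\<close>. Elements of \<open>\<real>\<^sup>N\<^sup>d\<close> are vectors indexed by
  \<open>(1 + 'm) \<times> 'd\<close>, and block matrices are indexed by sum types.
\<close>

section \<open>Matrices\<close>

definition kron :: "'a::times^'n^'m \<Rightarrow> 'a^'q^'p \<Rightarrow> 'a^('n \<times> 'q)^('m \<times> 'p)" where
  "kron A B = (\<chi> i j. A $ fst i $ fst j * B $ snd i $ snd j)"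

definition diag :: "('n \<Rightarrow> 'a::zero) \<Rightarrow> 'a^'n^'n" where
  "diag c = (\<chi> i j. if i = j then c i else 0)"

definition hcat :: "'a^'p^'m \<Rightarrow> 'a^'q^'m \<Rightarrow> 'a^('p + 'q)^'m" where
  "hcat A B = (\<chi> i j. case j of Inl p \<Rightarrow> A $ i $ p | Inr q \<Rightarrow> B $ i $ q)"

definition vcat :: "'a^'n^'p \<Rightarrow> 'a^'n^'q \<Rightarrow> 'a^'n^('p + 'q)" where
  "vcat A B = (\<chi> i j. case i of Inl p \<Rightarrow> A $ p $ j | Inr q \<Rightarrow> B $ q $ j)"

abbreviation complex_matrix :: "real^'n^'m \<Rightarrow> complex^'n^'m" where
  "complex_matrix \<equiv> map_matrix complex_of_real"

definition spectral_radius :: "real^'n^'n \<Rightarrow> real" where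
  "spectral_radius A = Max {cmod z | z. \<exists>v. v \<noteq> 0 \<and> complex_matrix A *v v = z *s v}"

definition transfer_matrix ::
  "real^'s^'s \<Rightarrow> real^'i^'s \<Rightarrow> real^'s^'o \<Rightarrow> complex \<Rightarrow> complex^'i^'o" where
  "transfer_matrix A B C z =
     complex_matrix C ** matrix_inv (mat z - complex_matrix A) ** complex_matrix B"

section \<open>Objective functions\<close>

definition gradient :: "('a::real_inner \<Rightarrow> real) \<Rightarrow> 'a \<Rightarrow> 'a" where
  "gradient f x = (THE D. GDERIV f x :> D)"

lemma gradient_eq: "GDERIV f x :> D \<Longrightarrow> gradient f x = D"
  unfolding gradient_def
proof (rule the_equality)
  fix D' assume a: "GDERIV f x :> D" "GDERIV f x :> D'"
  then have "(\<lambda>h. inner h D) = (\<lambda>h. inner h D')"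
    unfolding gderiv_def by (rule has_derivative_unique)
  then have "inner (D' - D) D = inner (D' - D) D'" by (rule fun_cong)
  then have "inner (D' - D) (D' - D) = 0" by (simp add: inner_diff_right)
  then show "D' = D" by simp
qed

lemma GDERIV_gradient:
  fixes f :: "'a::euclidean_space \<Rightarrow> real"
  assumes "f differentiable (at x)"
  shows "GDERIV f x :> gradient f x"
proof -
  from assms obtain F where F: "(f has_derivative F) (at x)" by (auto simp: differentiable_def)
  then interpret F: bounded_linear F by (rule has_derivative_bounded_linear)
  define D where "D = (\<Sum>b\<in>Basis. F b *\<^sub>R b)"
  have "F = (\<lambda>h. inner h D)"
  proof
    fix h
    have "F h = F (\<Sum>b\<in>Basis. inner h b *\<^sub>R b)" by (simp only: euclidean_representation)
    also have "\<dots> = inner h D"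
      by (simp add: D_def F.sum F.scaleR inner_sum_right mult.commute)
    finally show "F h = inner h D" .
  qed
  with F have "GDERIV f x :> D" by (simp only: gderiv_def)
  then show ?thesis by (simp only: gradient_eq)
qed

definition strongly_convex :: "real \<Rightarrow> ('a::real_inner \<Rightarrow> real) \<Rightarrow> bool" where
  "strongly_convex \<mu> f \<longleftrightarrow> convex_on UNIV (\<lambda>x. f x - \<mu> / 2 * (norm x)\<^sup>2)"

definition smooth :: "real \<Rightarrow> ('a::real_inner \<Rightarrow> real) \<Rightarrow> bool" where
  "smooth L f \<longleftrightarrow> L-lipschitz_on UNIV (gradient f)"

definition block :: "'n::finite \<Rightarrow> real^('n \<times> 'd::finite) \<Rightarrow> real^'d" where
  "block i x = (\<chi> j. x $ (i, j))"

definition grad_sum :: "('n::finite \<Rightarrow> real^'d \<Rightarrow> real) \<Rightarrow> real^('n \<times> 'd) \<Rightarrow> real^('n \<times> 'd)" where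
  "grad_sum f x = (\<chi> p. gradient (f (fst p)) (block (fst p) x) $ snd p)"

section \<open>The two algorithms\<close>

definition diging ::
  "('n::finite \<Rightarrow> real^'d \<Rightarrow> real) \<Rightarrow> real^'n^'n \<Rightarrow> real \<Rightarrow>
   (nat \<Rightarrow> real^('n \<times> 'd)) \<Rightarrow> (nat \<Rightarrow> real^('n \<times> 'd)) \<Rightarrow> bool" where
  "diging f W \<alpha> x y \<longleftrightarrow> (\<forall>k.
     x (Suc k) = kron W (mat 1) *v x k - \<alpha> *\<^sub>R y k \<and>
     y (Suc k) = kron W (mat 1) *v y k + grad_sum f (x (Suc k)) - grad_sum f (x k))"

definition augdgm ::
  "('n::finite \<Rightarrow> real^'d \<Rightarrow> real) \<Rightarrow> real^'n^'n \<Rightarrow> real \<Rightarrow>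
   (nat \<Rightarrow> real^('n \<times> 'd)) \<Rightarrow> (nat \<Rightarrow> real^('n \<times> 'd)) \<Rightarrow> bool" where
  "augdgm f W \<alpha> x y \<longleftrightarrow> (\<forall>k.
     x (Suc k) = kron W (mat 1) *v (x k - \<alpha> *\<^sub>R y k) \<and>
     y (Suc k) = kron W (mat 1) *v (y k + grad_sum f (x (Suc k)) - grad_sum f (x k)))"

section \<open>Transformed coordinates\<close>

definition to_modal :: "real^'n^'n \<Rightarrow> real^('n \<times> 'd::finite) \<Rightarrow> real^('n \<times> 'd)" where
  "to_modal U x = kron (transpose U) (mat 1) *v x"

definition modal_grad ::
  "('n::finite \<Rightarrow> real^'d \<Rightarrow> real) \<Rightarrow> real^'n^'n \<Rightarrow> real^('n \<times> 'd) \<Rightarrow> real^('n \<times> 'd)" where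
  "modal_grad f U xt = to_modal U (grad_sum f (kron U (mat 1) *v xt))"

text \<open>The transformed gradient is the gradient of the total cost as a function of the transformed variable.\<close>

lemma GDERIV_modal_grad:
  fixes f :: "'n::finite \<Rightarrow> real^'d \<Rightarrow> real"
  assumes "\<And>i x. f i differentiable (at x)"
  shows "GDERIV (\<lambda>xt. \<Sum>i\<in>UNIV. f i (block i (kron U (mat 1) *v xt))) xt :> modal_grad f U xt"
proof -
  let ?x = "kron U (mat 1 :: real^'d^'d) *v xt"
  have bl: "bounded_linear (\<lambda>x. block i (kron U (mat 1 :: real^'d^'d) *v x))" for i :: 'n
  proof -
    have "linear (\<lambda>x. block i (kron U (mat 1 :: real^'d^'d) *v x))"
      by (rule linearI)
        (simp_all only: matrix_vector_right_distrib matrix_vector_mult_scaleR, simp_all add: block_def vec_eq_iff)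
    then show ?thesis by (simp only: linear_conv_bounded_linear)
  qed
  have "((\<lambda>xt. \<Sum>i\<in>UNIV. f i (block i (kron U (mat 1) *v xt))) has_derivative
     (\<lambda>h. \<Sum>i\<in>UNIV. inner (block i (kron U (mat 1) *v h)) (gradient (f i) (block i ?x)))) (at xt)"
  proof (rule has_derivative_sum)
    fix i :: 'n
    have "((\<lambda>x. block i (kron U (mat 1 :: real^'d^'d) *v x)) has_derivative
        (\<lambda>x. block i (kron U (mat 1 :: real^'d^'d) *v x))) (at xt)"
      by (rule bounded_linear_imp_has_derivative[OF bl])
    from has_derivative_compose[OF this GDERIV_gradient[OF assms, unfolded gderiv_def]]
    show "((\<lambda>xt. f i (block i (kron U (mat 1) *v xt))) has_derivative
        (\<lambda>h. inner (block i (kron U (mat 1) *v h)) (gradient (f i) (block i ?x)))) (at xt)" .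
  qed
  moreover have "(\<Sum>i\<in>UNIV. inner (block i (kron U (mat 1) *v h)) (gradient (f i) (block i ?x)))
     = inner h (modal_grad f U xt)" for h
  proof -
    have t: "transpose (kron U (mat 1 :: real^'d^'d)) = kron (transpose U) (mat 1)"
      by (auto simp: kron_def transpose_def vec_eq_iff mat_def)
    have "(\<Sum>i\<in>UNIV. inner (block i z) (gradient (f i) (block i ?x))) = inner z (grad_sum f ?x)" for z
    proof -
      have "inner z (grad_sum f ?x) = (\<Sum>p\<in>UNIV \<times> UNIV. z $ p * gradient (f (fst p)) (block (fst p) ?x) $ snd p)"
        by (simp add: inner_vec_def grad_sum_def)
      also have "\<dots> = (\<Sum>i\<in>UNIV. \<Sum>j\<in>UNIV. z $ (i, j) * gradient (f i) (block i ?x) $ j)"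
        unfolding sum.cartesian_product by (rule sum.cong) auto
      finally show ?thesis by (simp add: inner_vec_def block_def)
    qed
    then have "?thesis \<longleftrightarrow> inner (kron U (mat 1 :: real^'d^'d) *v h) (grad_sum f ?x) = inner h (modal_grad f U xt)"
      by simp
    also have "\<dots>" unfolding modal_grad_def to_modal_def t[symmetric] transpose_matrix_vector
      by (subst (1 2) inner_commute) (rule dot_lmul_matrix[symmetric])
    finally show ?thesis by simp
  qed
  ultimately show ?thesis by (simp only: gderiv_def)
qed

text \<open>
  The nonlinearity maps the increments \<open>v k = xt (k + 1) - xt k\<close> to the increments of the transformed
  gradient. It is an operator on signals with memory: the point \<open>xt k\<close> at which the gradient increment
  is taken is recovered from the initial point \<open>x0\<close> and the past inputs.
\<close>

definition delta_op ::
  "('n::finite \<Rightarrow> real^'d \<Rightarrow> real) \<Rightarrow> real^'n^'n \<Rightarrow> real^('n \<times> 'd) \<Rightarrow>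
   (nat \<Rightarrow> real^('n \<times> 'd)) \<Rightarrow> nat \<Rightarrow> real^('n \<times> 'd)" where
  "delta_op f U x0 v k =
     modal_grad f U (x0 + (\<Sum>j\<le>k. v j)) - modal_grad f U (x0 + (\<Sum>j<k. v j))"

section \<open>State-space matrices\<close>

definition Lam :: "('m::finite \<Rightarrow> real) \<Rightarrow> real^(1 + 'm)^(1 + 'm)" where
  "Lam l = diag (case_sum (\<lambda>_. 1) l)"

definition A_DG :: "real \<Rightarrow> ('m::finite \<Rightarrow> real) \<Rightarrow>
    real^(('m + (1 + 'm)) \<times> 'd::finite)^(('m + (1 + 'm)) \<times> 'd)" where
  "A_DG \<alpha> l = kron (vcat (hcat (diag l) (hcat 0 (- \<alpha> *\<^sub>R mat 1)))
                        (hcat 0        (Lam l))) (mat 1)"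

definition B_DG :: "real^((1 + 'm::finite) \<times> 'd::finite)^(('m + (1 + 'm)) \<times> 'd)" where
  "B_DG = kron (vcat 0 (mat 1)) (mat 1)"

definition C_DG :: "real \<Rightarrow> ('m::finite \<Rightarrow> real) \<Rightarrow>
    real^(('m + (1 + 'm)) \<times> 'd::finite)^((1 + 'm) \<times> 'd)" where
  "C_DG \<alpha> l = kron (hcat (vcat 0 (diag l - mat 1)) (- \<alpha> *\<^sub>R mat 1)) (mat 1)"

definition A_AD :: "real \<Rightarrow> ('m::finite \<Rightarrow> real) \<Rightarrow>
    real^(('m + (1 + 'm)) \<times> 'd::finite)^(('m + (1 + 'm)) \<times> 'd)" where
  "A_AD \<alpha> l = kron (vcat (hcat (diag l) (hcat 0 (- \<alpha> *\<^sub>R diag l)))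
                        (hcat 0        (Lam l))) (mat 1)"

definition B_AD :: "('m::finite \<Rightarrow> real) \<Rightarrow> real^((1 + 'm) \<times> 'd::finite)^(('m + (1 + 'm)) \<times> 'd)" where
  "B_AD l = kron (vcat 0 (Lam l)) (mat 1)"

definition C_AD :: "real \<Rightarrow> ('m::finite \<Rightarrow> real) \<Rightarrow>
    real^(('m + (1 + 'm)) \<times> 'd::finite)^((1 + 'm) \<times> 'd)" where
  "C_AD \<alpha> l = kron (hcat (vcat 0 (diag l - mat 1)) (- \<alpha> *\<^sub>R Lam l)) (mat 1)"

section \<open>Interconnection\<close>

definition lti_system ::
  "real^'s^'s \<Rightarrow> real^'i^'s \<Rightarrow> real^'s^'o \<Rightarrow>
   (nat \<Rightarrow> real^'s) \<Rightarrow> (nat \<Rightarrow> real^'i) \<Rightarrow> (nat \<Rightarrow> real^'o) \<Rightarrow> bool" where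
  "lti_system A B C s u v \<longleftrightarrow> (\<forall>k. s (Suc k) = A *v s k + B *v u k \<and> v k = C *v s k)"

definition feedback_loop ::
  "real^'s^'s \<Rightarrow> real^'i^'s \<Rightarrow> real^'s^'o \<Rightarrow> ((nat \<Rightarrow> real^'o) \<Rightarrow> nat \<Rightarrow> real^'i) \<Rightarrow>
   (nat \<Rightarrow> real^'s) \<Rightarrow> (nat \<Rightarrow> real^'i) \<Rightarrow> (nat \<Rightarrow> real^'o) \<Rightarrow> bool" where
  "feedback_loop A B C \<Delta> s u v \<longleftrightarrow> lti_system A B C s u v \<and> u = \<Delta> v"

definition average_subsystem :: "real \<Rightarrow> (nat \<Rightarrow> real^'d) \<Rightarrow> (nat \<Rightarrow> real^'d) \<Rightarrow> bool" where
  "average_subsystem \<alpha> x1 y1 \<longleftrightarrow> (\<forall>k. x1 (Suc k) = x1 k - \<alpha> *\<^sub>R y1 k)"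

definition tracking_state ::
  "real^((1 + 'm::finite) \<times> 'd::finite) \<Rightarrow> real^((1 + 'm) \<times> 'd) \<Rightarrow> real^(('m + (1 + 'm)) \<times> 'd)" where
  "tracking_state xt yt =
     (\<chi> p. case fst p of Inl i \<Rightarrow> xt $ (Inr i, snd p) | Inr i \<Rightarrow> yt $ (i, snd p))"

definition interconnection ::
  "real^(('m::finite + (1 + 'm)) \<times> 'd::finite)^(('m + (1 + 'm)) \<times> 'd) \<Rightarrow>
   real^((1 + 'm) \<times> 'd)^(('m + (1 + 'm)) \<times> 'd) \<Rightarrow>
   real^(('m + (1 + 'm)) \<times> 'd)^((1 + 'm) \<times> 'd) \<Rightarrow>
   (1 + 'm \<Rightarrow> real^'d \<Rightarrow> real) \<Rightarrow> real^(1 + 'm)^(1 + 'm) \<Rightarrow> real \<Rightarrow>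
   (nat \<Rightarrow> real^((1 + 'm) \<times> 'd)) \<Rightarrow> (nat \<Rightarrow> real^((1 + 'm) \<times> 'd)) \<Rightarrow>
   (nat \<Rightarrow> real^((1 + 'm) \<times> 'd)) \<Rightarrow> (nat \<Rightarrow> real^((1 + 'm) \<times> 'd)) \<Rightarrow> bool" where
  "interconnection A B C f U \<alpha> xt yt u v \<longleftrightarrow>
     average_subsystem \<alpha> (\<lambda>k. block (Inl 1) (xt k)) (\<lambda>k. block (Inl 1) (yt k)) \<and>
     feedback_loop A B C (delta_op f U (xt 0)) (\<lambda>k. tracking_state (xt k) (yt k)) u v"

section \<open>Transfer functions\<close>

fun g_DG :: "real \<Rightarrow> ('m \<Rightarrow> real) \<Rightarrow> complex \<Rightarrow> 1 + 'm \<Rightarrow> complex" where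
  "g_DG \<alpha> l z (Inl _) = - (of_real \<alpha> / (z - 1))"
| "g_DG \<alpha> l z (Inr i) = - (of_real \<alpha> * (z - 1) / (z - of_real (l i))\<^sup>2)"

fun g_AD :: "real \<Rightarrow> ('m \<Rightarrow> real) \<Rightarrow> complex \<Rightarrow> 1 + 'm \<Rightarrow> complex" where
  "g_AD \<alpha> l z (Inl _) = - (of_real \<alpha> / (z - 1))"
| "g_AD \<alpha> l z (Inr i) = - (of_real \<alpha> * (z - 1) * (of_real (l i))\<^sup>2 / (z - of_real (l i))\<^sup>2)"

section \<open>Communication graph\<close>

definition connected_graph :: "('n \<times> 'n) set \<Rightarrow> bool" where
  "connected_graph E \<longleftrightarrow> sym E \<and> irrefl E \<and> E\<^sup>* = UNIV"

text \<open>
  \<open>W\<close> need not have nonnegative entries; the graph only forces zero weights between distinct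
  non-neighbours.
\<close>

definition weight_matrix :: "('n::finite \<times> 'n) set \<Rightarrow> real^'n^'n \<Rightarrow> bool" where
  "weight_matrix E W \<longleftrightarrow>
     (\<forall>i j. i \<noteq> j \<longrightarrow> (i, j) \<notin> E \<longrightarrow> W $ i $ j = 0) \<and>
     transpose W = W \<and> W *v (\<chi> i. 1) = (\<chi> i. 1) \<and>
     spectral_radius (W - (\<chi> i j. 1 / real CARD('n))) < 1"

definition spectral_decomposition ::
  "real^(1 + 'm)^(1 + 'm) \<Rightarrow> real^(1 + 'm)^(1 + 'm) \<Rightarrow> ('m::{finite,linorder} \<Rightarrow> real) \<Rightarrow> bool" where
  "spectral_decomposition W U l \<longleftrightarrow>
     orthogonal_matrix U \<and> column (Inl 1) U = (\<chi> i. 1 / sqrt (real CARD(1 + 'm))) \<and>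
     W = U ** Lam l ** transpose U \<and>
     antimono l \<and> (\<forall>i. -1 < l i \<and> l i < 1)"

end

theory Submission
  imports Defs
begin

text \<open>
  Both algorithms are instances of one scheme with a second weight matrix \<open>P\<close>,
  \<open>x(k+1) = W x(k) - \<alpha> P y(k)\<close>, \<open>y(k+1) = W y(k) + P (\<nabla>f(x(k+1)) - \<nabla>f(x(k)))\<close>: DIGing has \<open>P = I\<close>
  and AugDGM has \<open>P = W\<close>. Since \<open>I\<close> and \<open>W\<close> are diagonalized by the same orthogonal \<open>U\<close>, passing
  to \<open>xt = U\<^sup>T x\<close>, \<open>yt = U\<^sup>T y\<close> turns the scheme into scalar recursions, one for each eigenvalue
  \<open>\<lambda>\<^sub>i\<close> of \<open>W\<close> and \<open>q\<^sub>i\<close> of \<open>P\<close>: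
  \<open>xt\<^sub>i(k+1) = \<lambda>\<^sub>i xt\<^sub>i - \<alpha> q\<^sub>i yt\<^sub>i\<close>, \<open>yt\<^sub>i(k+1) = \<lambda>\<^sub>i yt\<^sub>i + q\<^sub>i u\<^sub>i\<close>, with \<open>\<lambda>\<^sub>1 = q\<^sub>1 = 1\<close>.
  The matrices of the tracking subsystem have the same form for every \<open>q\<close>, so everything is
  proved once for general \<open>q\<close> and specialized to \<open>q = 1\<close> and \<open>q = \<lambda>\<close> at the end.

  For the interconnection, the recursion for \<open>xt\<^sub>1\<close> is the average subsystem, the remaining ones are
  the state equation, and \<open>C\<close> expresses the increment \<open>xt(k+1) - xt(k)\<close> through the state at time \<open>k\<close>;
  in the first row nothing but \<open>-\<alpha> yt\<^sub>1\<close> survives because \<open>\<lambda>\<^sub>1 = 1\<close>, which is why \<open>xt\<^sub>1\<close> can be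
  left out of the state (\<open>modal_dynamics_iff_state_space\<close>). As \<open>v\<close> consists of increments of \<open>xt\<close>, the
  partial sums in the nonlinearity telescope and reproduce \<open>xt(k)\<close> itself
  (\<open>delta_op_increments\<close>), so the feedback law says exactly that \<open>u\<close> is the gradient increment.

  For the transfer function, \<open>z I - A\<close> is triangular with \<open>yt\<close> independent of \<open>xt\<close>, so it is invertible
  off the spectrum and the equation \<open>(z I - A) s = B u\<close> is solved by back substitution:
  \<open>yt\<^sub>i = q\<^sub>i u\<^sub>i / (z - \<lambda>\<^sub>i)\<close>, \<open>xt\<^sub>i = -\<alpha> q\<^sub>i yt\<^sub>i / (z - \<lambda>\<^sub>i)\<close>. Hence
  \<open>v\<^sub>i = (\<lambda>\<^sub>i - 1) xt\<^sub>i - \<alpha> q\<^sub>i yt\<^sub>i = -\<alpha> q\<^sub>i\<^sup>2 (z - 1) u\<^sub>i / (z - \<lambda>\<^sub>i)\<^sup>2\<close> (\<open>track_transfer_matrix\<close>).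
\<close>

section \<open>Block matrices acting on vectors\<close>

lemma sum_over_sum_type:
  fixes g :: "'a::finite + 'b::finite \<Rightarrow> 'c::comm_monoid_add"
  shows "(\<Sum>i\<in>UNIV. g i) = (\<Sum>i\<in>UNIV. g (Inl i)) + (\<Sum>i\<in>UNIV. g (Inr i))"
  by (simp add: UNIV_Plus_UNIV[symmetric] sum.Plus comp_def del: UNIV_Plus_UNIV)

lemma kron_mat_1_mult_component:
  fixes A :: "'a::semiring_1^'n^'m" and x :: "'a^('n \<times> 'd::finite)"
  shows "(kron A (mat 1 :: 'a^'d^'d) *v x) $ (i, j) = (\<Sum>k\<in>UNIV. A $ i $ k * x $ (k, j))"
proof -
  have "(kron A (mat 1 :: 'a^'d^'d) *v x) $ (i, j) =
      (\<Sum>p\<in>UNIV \<times> UNIV. A $ i $ fst p * (if j = snd p then 1 else 0) * x $ p)"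
    by (simp add: matrix_vector_mult_def kron_def mat_def)
  also have "\<dots> = (\<Sum>k\<in>UNIV. \<Sum>j'\<in>UNIV. A $ i $ k * (if j = j' then 1 else 0) * x $ (k, j'))"
    unfolding sum.cartesian_product by (rule sum.cong) auto
  also have "\<dots> = (\<Sum>k\<in>UNIV. A $ i $ k * x $ (k, j))"
    by (intro sum.cong refl) (simp add: if_distrib[of "\<lambda>t. _ * t * _"] cong: if_cong)
  finally show ?thesis .
qed

lemma kron_mat_1_mult_assoc:
  fixes A :: "'a::comm_semiring_1^'n^'m" and B :: "'a^'k^'n" and x :: "'a^('k \<times> 'd::finite)"
  shows "kron A (mat 1 :: 'a^'d^'d) *v (kron B (mat 1) *v x) = kron (A ** B) (mat 1) *v x"
  by (auto simp: vec_eq_iff kron_mat_1_mult_component matrix_matrix_mult_def sum_distrib_left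
      sum_distrib_right mult.assoc intro: sum.swap)

lemma kron_mat_1_mat_1: "kron (mat 1 :: 'a::semiring_1^'n^'n) (mat 1 :: 'a^'d^'d) = mat 1"
  by (auto simp: kron_def mat_def vec_eq_iff)

lemma kron_diag_mult_component:
  fixes c :: "'n::finite \<Rightarrow> 'a::semiring_1"
  shows "(kron (diag c) (mat 1 :: 'a^'d^'d) *v x) $ (i, j) = c i * x $ (i, j)"
  by (simp add: kron_mat_1_mult_component diag_def if_distrib[of "\<lambda>t. t * _"] cong: if_cong)

lemma map_matrix_of_real_kron_mat_1:
  "map_matrix of_real (kron A (mat 1 :: real^'d^'d)) =
     kron (map_matrix of_real A) (mat 1 :: 'a::{real_algebra_1}^'d^'d)"
  by (auto simp: kron_def mat_def vec_eq_iff)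

lemma map_matrix_of_real_id: "map_matrix of_real A = (A :: real^'n^'m)"
  by (simp add: vec_eq_iff)

section \<open>State-space matrices for a general second weight matrix\<close>

text \<open>
  The parameters \<open>q\<close> are the eigenvalues, other than the first, of the weight matrix \<open>P\<close> through
  which the tracker enters the update of \<open>x\<close> and the gradient increment enters the update of \<open>y\<close>.
\<close>

definition track_A :: "real \<Rightarrow> ('m::finite \<Rightarrow> real) \<Rightarrow> ('m \<Rightarrow> real) \<Rightarrow>
    real^(('m + (1 + 'm)) \<times> 'd::finite)^(('m + (1 + 'm)) \<times> 'd)" where
  "track_A \<alpha> l q = kron (vcat (hcat (diag l) (hcat 0 (- \<alpha> *\<^sub>R diag q)))
                            (hcat 0        (Lam l))) (mat 1)"

definition track_B :: "('m::finite \<Rightarrow> real) \<Rightarrow> real^((1 + 'm) \<times> 'd::finite)^(('m + (1 + 'm)) \<times> 'd)" where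
  "track_B q = kron (vcat 0 (Lam q)) (mat 1)"

definition track_C :: "real \<Rightarrow> ('m::finite \<Rightarrow> real) \<Rightarrow> ('m \<Rightarrow> real) \<Rightarrow>
    real^(('m + (1 + 'm)) \<times> 'd::finite)^((1 + 'm) \<times> 'd)" where
  "track_C \<alpha> l q = kron (hcat (vcat 0 (diag l - mat 1)) (- \<alpha> *\<^sub>R Lam q)) (mat 1)"

lemma diag_1: "diag (\<lambda>_. 1) = (mat 1 :: 'a::zero_neq_one^'n^'n)"
  by (simp add: diag_def mat_def)

lemma Lam_1: "Lam (\<lambda>_. 1) = mat 1"
proof -
  have "case_sum (\<lambda>_. 1) (\<lambda>_. 1) = (\<lambda>_. 1 :: real)" by (auto split: sum.split)
  then show ?thesis by (simp add: Lam_def diag_1)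
qed

lemma DG_matrices:
  "A_DG \<alpha> l = track_A \<alpha> l (\<lambda>_. 1)" "B_DG = track_B (\<lambda>_. 1)" "C_DG \<alpha> l = track_C \<alpha> l (\<lambda>_. 1)"
  by (simp_all add: A_DG_def B_DG_def C_DG_def track_A_def track_B_def track_C_def diag_1 Lam_1)

lemma AD_matrices:
  "A_AD \<alpha> l = track_A \<alpha> l l" "B_AD l = track_B l" "C_AD \<alpha> l = track_C \<alpha> l l"
  by (simp_all add: A_AD_def B_AD_def C_AD_def track_A_def track_B_def track_C_def)

lemmas block_entry_simps = sum_over_sum_type
  vcat_def hcat_def Lam_def diag_def mat_def sum_distrib_left left_diff_distrib sum_subtractf sum_negf
  if_distrib[of of_real] if_distrib[of "\<lambda>t. t * _"]  if_distrib[of "\<lambda>t. _ * t"]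

text \<open>
  The field is arbitrary so that the same formulas serve the real dynamics and the complex
  resolvent.
\<close>

lemma track_A_mult:
  fixes s :: "'a::real_field^(('m::finite + (1 + 'm)) \<times> 'd::finite)"
  shows "(map_matrix of_real (track_A \<alpha> l q) *v s) $ (Inl i, j) =
      of_real (l i) * s $ (Inl i, j) - of_real (\<alpha> * q i) * s $ (Inr (Inr i), j)"
    and "(map_matrix of_real (track_A \<alpha> l q) *v s) $ (Inr (Inl 1), j) = s $ (Inr (Inl 1), j)"
    and "(map_matrix of_real (track_A \<alpha> l q) *v s) $ (Inr (Inr i), j) =
      of_real (l i) * s $ (Inr (Inr i), j)"
  unfolding track_A_def map_matrix_of_real_kron_mat_1 kron_mat_1_mult_component
  by (simp_all add: block_entry_simps cong: if_cong)

lemma track_B_mult: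
  fixes u :: "'a::real_field^((1 + 'm::finite) \<times> 'd::finite)"
  shows "(map_matrix of_real (track_B q) *v u) $ (Inl i, j) = 0"
    and "(map_matrix of_real (track_B q) *v u) $ (Inr (Inl 1), j) = u $ (Inl 1, j)"
    and "(map_matrix of_real (track_B q) *v u) $ (Inr (Inr i), j) = of_real (q i) * u $ (Inr i, j)"
  unfolding track_B_def map_matrix_of_real_kron_mat_1 kron_mat_1_mult_component
  by (simp_all add: block_entry_simps cong: if_cong)

lemma track_C_mult:
  fixes s :: "'a::real_field^(('m::finite + (1 + 'm)) \<times> 'd::finite)"
  shows "(map_matrix of_real (track_C \<alpha> l q) *v s) $ (Inl 1, j) = - of_real \<alpha> * s $ (Inr (Inl 1), j)"
    and "(map_matrix of_real (track_C \<alpha> l q) *v s) $ (Inr i, j) =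
      of_real (l i - 1) * s $ (Inl i, j) - of_real (\<alpha> * q i) * s $ (Inr (Inr i), j)"
  unfolding track_C_def map_matrix_of_real_kron_mat_1 kron_mat_1_mult_component
  by (simp_all add: block_entry_simps cong: if_cong)

section \<open>Resolvent and transfer matrix\<close>

lemma invertible_iff_ker_trivial:
  fixes A :: "'a::field^'n^'n"
  shows "invertible A \<longleftrightarrow> (\<forall>x. A *v x = 0 \<longrightarrow> x = 0)"
  by (simp add: invertible_left_inverse matrix_left_invertible_ker)

lemma mat_mult_component: "(mat z *v x) $ i = z * x $ i" for z :: "'a::comm_semiring_1"
  by (simp add: matrix_vector_mult_def mat_def if_distrib[of "\<lambda>t. t * _"] cong: if_cong)

lemma all_num1: "(\<forall>x::1. P x) \<longleftrightarrow> P 1"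
  by (metis num1_eq1)

lemma all_track_index:
  "(\<forall>p :: ('m + (1 + 'm)) \<times> 'd. P p) \<longleftrightarrow>
     (\<forall>i j. P (Inl i, j)) \<and> (\<forall>j. P (Inr (Inl 1), j)) \<and> (\<forall>i j. P (Inr (Inr i), j))"
  by (simp add: split_paired_All split_sum_all all_num1)

lemma all_modal_index:
  "(\<forall>p :: (1 + 'm) \<times> 'd. P p) \<longleftrightarrow> (\<forall>j. P (Inl 1, j)) \<and> (\<forall>i j. P (Inr i, j))"
  by (simp add: split_paired_All split_sum_all all_num1)

text \<open>
  The resolvent equation splits into one triangular \<open>2 \<times> 2\<close> system for each mode, and a scalar equation
  for the average mode.
\<close>

lemma track_resolvent_eq_iff:
  fixes s r :: "complex^(('m::finite + (1 + 'm)) \<times> 'd::finite)"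
  shows "(mat z - complex_matrix (track_A \<alpha> l q)) *v s = r \<longleftrightarrow>
     (\<forall>i j. (z - l i) * s $ (Inl i, j) + of_real (\<alpha> * q i) * s $ (Inr (Inr i), j) = r $ (Inl i, j)) \<and>
     (\<forall>j. (z - 1) * s $ (Inr (Inl 1), j) = r $ (Inr (Inl 1), j)) \<and>
     (\<forall>i j. (z - l i) * s $ (Inr (Inr i), j) = r $ (Inr (Inr i), j))"
  unfolding vec_eq_iff all_track_index matrix_vector_mult_diff_rdistrib vector_minus_component
    mat_mult_component track_A_mult
  by (simp add: left_diff_distrib diff_diff_eq2 diff_add_eq)

text \<open>
  The matrix is triangular with the eigenvalues on its diagonal: a kernel vector off the spectrum
  vanishes by back substitution, and on the spectrum the indicator of the average mode of \<open>y\<close>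
  (for 1) or of mode \<open>i\<close> of \<open>x\<close> (for \<open>l i\<close>) lies in the kernel whatever the coupling \<open>\<alpha> q\<close> is.
\<close>

lemma track_A_resolvent_set:
  "invertible (mat z - complex_matrix (track_A \<alpha> l q ::
      real^(('m::finite + (1 + 'm)) \<times> 'd::finite)^_)) \<longleftrightarrow>
     z \<notin> insert 1 (range (\<lambda>i. complex_of_real (l i)))" (is "invertible ?M \<longleftrightarrow> _")
proof
  assume inv: "invertible ?M"
  have kernel: "?M *v s = 0 \<Longrightarrow> s = 0" for s
    using inv by (simp add: invertible_iff_ker_trivial)
  show "z \<notin> insert 1 (range (\<lambda>i. complex_of_real (l i)))"
  proof
    assume "z \<in> insert 1 (range (\<lambda>i. complex_of_real (l i)))"
    then consider "z = 1" | i where "z = l i" by auto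
    then show False
    proof cases
      case 1
      let ?s = "(\<chi> p. if fst p = Inr (Inl 1) then 1 else 0) :: complex^(('m + (1 + 'm)) \<times> 'd)"
      have "?M *v ?s = 0" by (simp add: track_resolvent_eq_iff 1)
      from kernel[OF this] have "?s $ (Inr (Inl 1), undefined) = 0" by (simp only: zero_index)
      then show False by simp
    next
      case 2
      let ?s = "(\<chi> p. if fst p = Inl i then 1 else 0) :: complex^(('m + (1 + 'm)) \<times> 'd)"
      have "?M *v ?s = 0" by (simp add: track_resolvent_eq_iff 2)
      from kernel[OF this] have "?s $ (Inl i, undefined) = 0" by (simp only: zero_index)
      then show False by simp
    qed
  qed
next
  assume z: "z \<notin> insert 1 (range (\<lambda>i. complex_of_real (l i)))"
  then have nz: "z - 1 \<noteq> 0" "z - l i \<noteq> 0" for i by auto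
  show "invertible ?M"
    unfolding invertible_iff_ker_trivial
  proof (intro allI impI)
    fix s
    assume "?M *v s = 0"
    then have x: "\<And>i j. (z - l i) * s $ (Inl i, j) + of_real (\<alpha> * q i) * s $ (Inr (Inr i), j) = 0"
      and y1: "\<And>j. (z - 1) * s $ (Inr (Inl 1), j) = 0"
      and y: "\<And>i j. (z - l i) * s $ (Inr (Inr i), j) = 0"
      unfolding track_resolvent_eq_iff zero_index by blast+
    from y1 y have y1: "s $ (Inr (Inl 1), j) = 0" and y: "s $ (Inr (Inr i), j) = 0" for i j
      using nz by (simp_all only: mult_eq_0_iff simp_thms)
    \<comment> \<open>Back substitution: once the \<open>y\<close> block is known to vanish, so does the \<open>x\<close> block.\<close>
    from x have "s $ (Inl i, j) = 0" for i j
      using nz by (simp add: y)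
    with y1 y show "s = 0"
      unfolding vec_eq_iff all_track_index zero_index by blast
  qed
qed

lemma matrix_inv_mult_eqI:
  fixes A :: "'a::field^'n^'n"
  assumes "invertible A" "A *v s = r"
  shows "matrix_inv A *v r = s"
proof -
  have "matrix_inv A ** A = mat 1"
    using assms(1) unfolding invertible_def matrix_inv_def by (rule someI2_ex) blast
  then show ?thesis
    by (simp add: assms(2)[symmetric] matrix_vector_mul_assoc)
qed

text \<open>
  Matrices are compared through their action on an arbitrary input \<open>u\<close>; the value of the resolvent
  at \<open>B u\<close> is then a vector that can be written down and checked, so that no inverse matrix has to
  be computed.
\<close>

lemma track_transfer_matrix:
  fixes l q :: "'m::finite \<Rightarrow> real"
  assumes "z \<notin> insert 1 (range (\<lambda>i. complex_of_real (l i)))"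
  shows "transfer_matrix (track_A \<alpha> l q) (track_B q) (track_C \<alpha> l q) z =
     kron (diag (case_sum (\<lambda>_. - (of_real \<alpha> / (z - 1)))
       (\<lambda>i. - (of_real \<alpha> * (z - 1) * (of_real (q i))\<^sup>2 / (z - of_real (l i))\<^sup>2))))
       (mat 1 :: complex^'d::finite^'d)"
proof -
  let ?A = "complex_matrix (track_A \<alpha> l q :: real^(('m + (1 + 'm)) \<times> 'd)^_)"
  let ?B = "complex_matrix (track_B q :: real^_^(('m + (1 + 'm)) \<times> 'd))"
  let ?C = "complex_matrix (track_C \<alpha> l q :: real^(('m + (1 + 'm)) \<times> 'd)^_)"
  let ?G = "kron (diag (case_sum (\<lambda>_. - (of_real \<alpha> / (z - 1)))
       (\<lambda>i. - (of_real \<alpha> * (z - 1) * (of_real (q i))\<^sup>2 / (z - of_real (l i))\<^sup>2))))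
       (mat 1 :: complex^'d^'d)"
  have nz: "z - 1 \<noteq> 0" "z - l i \<noteq> 0" for i using assms by auto
  have "?C *v (matrix_inv (mat z - ?A) *v (?B *v u)) = ?G *v u" for u
  proof -
    \<comment> \<open>The solution by back substitution, first in the \<open>y\<close> block and then in the \<open>x\<close> block.\<close>
    define s :: "complex^(('m + (1 + 'm)) \<times> 'd)" where
      "s = (\<chi> p. case fst p of
          Inl i \<Rightarrow> - (of_real \<alpha> * (of_real (q i))\<^sup>2 * u $ (Inr i, snd p) / (z - l i)\<^sup>2)
        | Inr (Inl o1) \<Rightarrow> u $ (Inl o1, snd p) / (z - 1)
        | Inr (Inr i) \<Rightarrow> of_real (q i) * u $ (Inr i, snd p) / (z - l i))"
    have "(mat z - ?A) *v s = ?B *v u"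
      using nz by (simp add: track_resolvent_eq_iff s_def track_B_mult power2_eq_square)
    with track_A_resolvent_set assms have "matrix_inv (mat z - ?A) *v (?B *v u) = s"
      by (blast intro: matrix_inv_mult_eqI)
    moreover have "?C *v s = ?G *v u"
      unfolding vec_eq_iff all_modal_index track_C_mult kron_diag_mult_component
      using nz by (simp add: s_def) (simp add: divide_simps, simp add: algebra_simps power2_eq_square)
    ultimately show ?thesis by simp
  qed
  then show ?thesis
    by (simp add: matrix_eq transfer_matrix_def matrix_vector_mul_assoc[symmetric])
qed

section \<open>The common form of the two algorithms\<close>

definition gradient_tracking ::
  "('n::finite \<Rightarrow> real^'d \<Rightarrow> real) \<Rightarrow> real^'n^'n \<Rightarrow> real^'n^'n \<Rightarrow> real \<Rightarrow>
   (nat \<Rightarrow> real^('n \<times> 'd)) \<Rightarrow> (nat \<Rightarrow> real^('n \<times> 'd)) \<Rightarrow> bool" where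
  "gradient_tracking f W P \<alpha> x y \<longleftrightarrow> (\<forall>k.
     x (Suc k) = kron W (mat 1) *v x k - \<alpha> *\<^sub>R (kron P (mat 1) *v y k) \<and>
     y (Suc k) = kron W (mat 1) *v y k + kron P (mat 1) *v (grad_sum f (x (Suc k)) - grad_sum f (x k)))"

lemma diging_eq_gradient_tracking: "diging f W \<alpha> = gradient_tracking f W (mat 1) \<alpha>"
  by (simp add: fun_eq_iff diging_def gradient_tracking_def kron_mat_1_mat_1 add_diff_eq)

lemma augdgm_eq_gradient_tracking: "augdgm f W \<alpha> = gradient_tracking f W W \<alpha>"
  by (simp add: fun_eq_iff augdgm_def gradient_tracking_def matrix_vector_right_distrib
      matrix_vector_mult_diff_distrib matrix_vector_mult_scaleR add_diff_eq)

section \<open>Modal coordinates\<close>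

lemma from_to_modal:
  assumes "orthogonal_matrix U"
  shows "kron U (mat 1) *v to_modal U x = x"
  using assms
  by (simp add: to_modal_def kron_mat_1_mult_assoc orthogonal_matrix_def kron_mat_1_mat_1)

lemma to_modal_eq_iff:
  assumes "orthogonal_matrix U"
  shows "to_modal U x = to_modal U y \<longleftrightarrow> x = y"
  by (metis assms from_to_modal)

text \<open>
  Orthogonality turns \<open>M = U D U\<^sup>T\<close> into \<open>U\<^sup>T M = D U\<^sup>T\<close>, so the change of coordinates intertwines
  \<open>M\<close> with \<open>D\<close>.
\<close>

lemma to_modal_diagonalizable:
  assumes "orthogonal_matrix U" "M = U ** D ** transpose U"
  shows "to_modal U (kron M (mat 1) *v x) = kron D (mat 1) *v to_modal U x"
proof -
  have "transpose U ** M = (transpose U ** U) ** D ** transpose U"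
    by (simp add: assms(2) matrix_mul_assoc)
  also have "\<dots> = D ** transpose U"
    using assms(1) by (simp add: orthogonal_matrix_def)
  finally show ?thesis
    by (simp add: to_modal_def kron_mat_1_mult_assoc)
qed

lemma to_modal_linear:
  "to_modal U (x + y) = to_modal U x + to_modal U y"
  "to_modal U (x - y) = to_modal U x - to_modal U y"
  "to_modal U (c *\<^sub>R x) = c *\<^sub>R to_modal U x"
  by (simp_all add: to_modal_def matrix_vector_right_distrib matrix_vector_mult_diff_distrib
      matrix_vector_mult_scaleR)

lemma to_modal_grad_sum:
  assumes "orthogonal_matrix U"
  shows "to_modal U (grad_sum f x) = modal_grad f U (to_modal U x)"
  by (simp add: modal_grad_def from_to_modal[OF assms])

text \<open>
  An equivalence, and not just an implication, because the change of coordinates is injective: this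
  is what lets an interconnection be read back as a run of the algorithm.
\<close>

lemma gradient_tracking_modal:
  assumes U: "orthogonal_matrix U"
    and W: "W = U ** Lam l ** transpose U" and P: "P = U ** Lam q ** transpose U"
  shows "gradient_tracking f W P \<alpha> x y \<longleftrightarrow> (\<forall>k.
     to_modal U (x (Suc k)) =
       kron (Lam l) (mat 1) *v to_modal U (x k) - \<alpha> *\<^sub>R (kron (Lam q) (mat 1) *v to_modal U (y k)) \<and>
     to_modal U (y (Suc k)) = kron (Lam l) (mat 1) *v to_modal U (y k) +
       kron (Lam q) (mat 1) *v (modal_grad f U (to_modal U (x (Suc k))) - modal_grad f U (to_modal U (x k))))"
  unfolding gradient_tracking_def to_modal_grad_sum[OF U, symmetric]
    to_modal_linear[symmetric] to_modal_diagonalizable[OF U W, symmetric]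
    to_modal_diagonalizable[OF U P, symmetric] to_modal_eq_iff[OF U] ..

section \<open>The interconnection\<close>

text \<open>
  The operator recovers the current point from the initial point and the past increments; for an
  input that really consists of increments these sums telescope.
\<close>

lemma delta_op_increments:
  assumes "v = (\<lambda>k. xt (Suc k) - xt k)"
  shows "delta_op f U (xt 0) v = (\<lambda>k. modal_grad f U (xt (Suc k)) - modal_grad f U (xt k))"
  by (simp add: fun_eq_iff delta_op_def assms lessThan_Suc_atMost[symmetric]
      sum_lessThan_telescope del: sum.lessThan_Suc)

lemmas track_mult_real =
  track_A_mult[where 'a = real, unfolded map_matrix_of_real_id, unfolded of_real_eq_id id_apply]
  track_B_mult[where 'a = real, unfolded map_matrix_of_real_id, unfolded of_real_eq_id id_apply]
  track_C_mult[where 'a = real, unfolded map_matrix_of_real_id, unfolded of_real_eq_id id_apply]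

text \<open>
  The exchange is componentwise. In the forward direction the output equation follows by
  inserting the recursion into \<open>x1 - x0\<close>; backwards, the average subsystem supplies the component
  of \<open>x\<close> that is missing from the state.
\<close>

lemma modal_dynamics_iff_state_space:
  fixes l q :: "'m::finite \<Rightarrow> real" and x0 x1 y0 y1 u v :: "real^((1 + 'm) \<times> 'd::finite)"
  shows "x1 = kron (Lam l) (mat 1) *v x0 - \<alpha> *\<^sub>R (kron (Lam q) (mat 1) *v y0) \<and>
      y1 = kron (Lam l) (mat 1) *v y0 + kron (Lam q) (mat 1) *v u \<and> v = x1 - x0 \<longleftrightarrow>
    block (Inl 1) x1 = block (Inl 1) x0 - \<alpha> *\<^sub>R block (Inl 1) y0 \<and>
      tracking_state x1 y1 = track_A \<alpha> l q *v tracking_state x0 y0 + track_B q *v u \<and>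
      v = track_C \<alpha> l q *v tracking_state x0 y0"
  unfolding vec_eq_iff all_track_index all_modal_index block_def Lam_def kron_diag_mult_component
    vector_add_component vector_minus_component vector_scaleR_component
    track_mult_real
  by (simp add: tracking_state_def) (auto simp: left_diff_distrib)

text \<open>
  The order of the argument matters: the output equation first identifies \<open>v\<close> with the increments
  for an arbitrary \<open>u\<close>, and only then can the feedback law be evaluated by telescoping.
\<close>

lemma interconnection_iff_gradient_tracking:
  assumes U: "orthogonal_matrix U"
    and W: "W = U ** Lam l ** transpose U" and P: "P = U ** Lam q ** transpose U"
  shows "interconnection (track_A \<alpha> l q) (track_B q) (track_C \<alpha> l q) f U \<alpha>
        (\<lambda>k. to_modal U (x k)) (\<lambda>k. to_modal U (y k)) u v \<longleftrightarrow>
      gradient_tracking f W P \<alpha> x y \<and>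
      u = (\<lambda>k. modal_grad f U (to_modal U (x (Suc k))) - modal_grad f U (to_modal U (x k))) \<and>
      v = (\<lambda>k. to_modal U (x (Suc k)) - to_modal U (x k))"
proof -
  let ?x = "\<lambda>k. to_modal U (x k)" and ?y = "\<lambda>k. to_modal U (y k)"
  let ?u = "\<lambda>k. modal_grad f U (?x (Suc k)) - modal_grad f U (?x k)"
  let ?v = "\<lambda>k. ?x (Suc k) - ?x k"
  let ?dyn = "\<lambda>k. ?x (Suc k) = kron (Lam l) (mat 1) *v ?x k - \<alpha> *\<^sub>R (kron (Lam q) (mat 1) *v ?y k) \<and>
      ?y (Suc k) = kron (Lam l) (mat 1) *v ?y k + kron (Lam q) (mat 1) *v u k"
  have "interconnection (track_A \<alpha> l q) (track_B q) (track_C \<alpha> l q) f U \<alpha> ?x ?y u v \<longleftrightarrow>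
      (\<forall>k. ?dyn k \<and> v k = ?v k) \<and> u = delta_op f U (?x 0) v"
    unfolding interconnection_def average_subsystem_def feedback_loop_def lti_system_def
      conj_assoc modal_dynamics_iff_state_space by blast
  also have "\<dots> \<longleftrightarrow> (\<forall>k. ?dyn k) \<and> v = ?v \<and> u = delta_op f U (?x 0) v"
    by (auto simp: fun_eq_iff)
  also have "\<dots> \<longleftrightarrow> (\<forall>k. ?dyn k) \<and> v = ?v \<and> u = ?u"
    by (intro conj_cong refl) (simp only: delta_op_increments[where xt = ?x])
  also have "\<dots> \<longleftrightarrow> gradient_tracking f W P \<alpha> x y \<and> u = ?u \<and> v = ?v"
    unfolding gradient_tracking_modal[OF U W P] by auto
  finally show ?thesis .
qed

text \<open>
  The two transfer functions are written with an explicit \<open>q\<close>, here the constant 1 and below \<open>l\<close>, to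
  have the shape of the general formula.
\<close>

lemma g_DG_eq_case_sum: "g_DG \<alpha> l z = case_sum (\<lambda>_. - (of_real \<alpha> / (z - 1)))
    (\<lambda>i. - (of_real \<alpha> * (z - 1) * (of_real 1)\<^sup>2 / (z - of_real (l i))\<^sup>2))"
  by (auto simp: fun_eq_iff split: sum.split)

lemma g_AD_eq_case_sum: "g_AD \<alpha> l z = case_sum (\<lambda>_. - (of_real \<alpha> / (z - 1)))
    (\<lambda>i. - (of_real \<alpha> * (z - 1) * (of_real (l i))\<^sup>2 / (z - of_real (l i))\<^sup>2))"
  by (auto simp: fun_eq_iff split: sum.split)

theorem theorem3:
  fixes f :: "1 + 'm::{finite,linorder} \<Rightarrow> real^'d \<Rightarrow> real"
    and E :: "((1 + 'm) \<times> (1 + 'm)) set"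
    and W U :: "real^(1 + 'm)^(1 + 'm)"
    and l :: "'m \<Rightarrow> real"
    and \<mu> L \<alpha> :: real
  assumes "0 < \<mu>" and "\<mu> \<le> L"
    and "\<And>i x. f i differentiable (at x)"
    and "\<And>i. strongly_convex \<mu> (f i)"
    and "\<And>i. smooth L (f i)"
    and "connected_graph E"
    and "weight_matrix E W"
    and "spectral_decomposition W U l"
    and "0 < \<alpha>"
  shows
    "(\<forall>x y u v.
        interconnection (A_DG \<alpha> l) B_DG (C_DG \<alpha> l) f U \<alpha>
          (\<lambda>k. to_modal U (x k)) (\<lambda>k. to_modal U (y k)) u v \<longleftrightarrow>
        diging f W \<alpha> x y \<and>
        u = (\<lambda>k. modal_grad f U (to_modal U (x (Suc k))) - modal_grad f U (to_modal U (x k))) \<and>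
        v = (\<lambda>k. to_modal U (x (Suc k)) - to_modal U (x k))) \<and>
     (\<forall>x y u v.
        interconnection (A_AD \<alpha> l) (B_AD l) (C_AD \<alpha> l) f U \<alpha>
          (\<lambda>k. to_modal U (x k)) (\<lambda>k. to_modal U (y k)) u v \<longleftrightarrow>
        augdgm f W \<alpha> x y \<and>
        u = (\<lambda>k. modal_grad f U (to_modal U (x (Suc k))) - modal_grad f U (to_modal U (x k))) \<and>
        v = (\<lambda>k. to_modal U (x (Suc k)) - to_modal U (x k))) \<and>
     (\<forall>z. invertible (mat z - complex_matrix (A_DG \<alpha> l :: real^(('m + (1 + 'm)) \<times> 'd)^_)) \<longleftrightarrow>
        z \<notin> insert 1 (range (\<lambda>i. complex_of_real (l i)))) \<and>
     (\<forall>z. invertible (mat z - complex_matrix (A_AD \<alpha> l :: real^(('m + (1 + 'm)) \<times> 'd)^_)) \<longleftrightarrow>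
        z \<notin> insert 1 (range (\<lambda>i. complex_of_real (l i)))) \<and>
     (\<forall>z. z \<notin> insert 1 (range (\<lambda>i. complex_of_real (l i))) \<longrightarrow>
        transfer_matrix (A_DG \<alpha> l) B_DG (C_DG \<alpha> l) z
          = kron (diag (g_DG \<alpha> l z)) (mat 1 :: complex^'d^'d) \<and>
        transfer_matrix (A_AD \<alpha> l) (B_AD l) (C_AD \<alpha> l) z
          = kron (diag (g_AD \<alpha> l z)) (mat 1 :: complex^'d^'d))"
proof -
  from assms(8) have U: "orthogonal_matrix U" and W: "W = U ** Lam l ** transpose U"
    by (auto simp: spectral_decomposition_def)
  have I: "mat 1 = U ** Lam (\<lambda>_. 1) ** transpose U"
    using U by (simp add: Lam_1 orthogonal_matrix_def)
  show ?thesis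
    unfolding DG_matrices AD_matrices diging_eq_gradient_tracking augdgm_eq_gradient_tracking
      g_DG_eq_case_sum g_AD_eq_case_sum
    by (intro conjI allI impI interconnection_iff_gradient_tracking[OF U W I]
        interconnection_iff_gradient_tracking[OF U W W] track_A_resolvent_set
        track_transfer_matrix)
qed

end
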